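(* Let $n$ be an even integer with $n>4$, let $D_{2n}$ be the dihedral group of order $2n$, and let $\Gamma=\Gamma_{D_{2n}\times D_{2n}}$ be the non-commuting graph of $D_{2n}\times D_{2n}$. Let $\alpha_1,\alpha_2,\alpha_3$ be the roots of $-x^{3}-(2n+4)x^{2}+16n(n-2)$, and let $\gamma_1,\dots,\gamma_8$ be the roots of the degree $8$ polynomial $f(x)$ determined by $$P_{\Gamma}(x)=\frac{(-x)^{\frac{15n^2}{4}-2n-3}}{(-x)^{4}}\,(-x-4)^{\frac{n^2}{4}-n+1}\,\bigl(-x^{3}-(2n+4)x^{2}+16n(n-2)\bigr)^{n-2}f(x).$$ Then the energy of $\Gamma$ is $$E(\Gamma_{D_{2n}\times D_{2n}})=(n^{2}-4n+4)+(n-2)\bigl(|\alpha_1|+|\alpha_2|+|\alpha_3|\bigr)+\sum_{i=1}^{8}|\gamma_i|.$$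
   Context: For a finite non-abelian group $G$ with center $Z(G)$, the non-commuting graph $\Gamma_G=\Gamma(G)$ is the simple graph with vertex set $G\setminus Z(G)$ in which two vertices $x,y$ are adjacent if and only if $xy\ne yx$. $P_{\Gamma}(x)=\det(xI-A)$ is the characteristic polynomial of the adjacency matrix $A$ of $\Gamma$ (here the number of vertices is even, so this equals $\det(A-xI)$). The energy of a graph is the sum of the absolute values of the eigenvalues (with multiplicity) of its adjacency matrix. *)

theory Defs
  imports
    "HOL-Algebra.Group"
    "Jordan_Normal_Form.Spectral_Radius"
    "Graph_Theory.Pair_Digraph"
begin

text \<open>
  The dihedral group of order \<open>2 * n\<close>: the pair \<open>(i, s)\<close> stands for \<open>a ^ i * b ^ s\<close>, where
  \<open>a\<close> is a rotation of order \<open>n\<close>, \<open>b\<close> a reflection and \<open>b * a * b = a ^ (- 1)\<close>;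
  \<open>s\<close> says whether the element is a reflection.
\<close>

definition dihedral :: "nat \<Rightarrow> (int \<times> bool) monoid" where
  "dihedral n =
     \<lparr> carrier = {0..<int n} \<times> UNIV,
       mult = (\<lambda>(i, s) (j, t). ((if s then i - j else i + j) mod int n, s \<noteq> t)),
       one = (0, False) \<rparr>"

lemma group_dihedral:
  assumes "n > 0"
  shows "group (dihedral n)"
proof (rule groupI)
  fix x y z
  assume "x \<in> carrier (dihedral n)" "y \<in> carrier (dihedral n)" "z \<in> carrier (dihedral n)"
  show "x \<otimes>\<^bsub>dihedral n\<^esub> y \<otimes>\<^bsub>dihedral n\<^esub> z = x \<otimes>\<^bsub>dihedral n\<^esub> (y \<otimes>\<^bsub>dihedral n\<^esub> z)"
    by (cases x; cases y; cases z) (auto simp: dihedral_def mod_simps algebra_simps)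
next
  fix x
  assume x: "x \<in> carrier (dihedral n)"
  show "\<exists>y\<in>carrier (dihedral n). y \<otimes>\<^bsub>dihedral n\<^esub> x = \<one>\<^bsub>dihedral n\<^esub>"
  proof (cases "snd x")
    case True
    with x show ?thesis
      by (intro bexI[of _ x]) (auto simp: dihedral_def)
  next
    case False
    with x assms show ?thesis
      by (intro bexI[of _ "((- fst x) mod int n, False)"]) (auto simp: dihedral_def mod_simps)
  qed
qed (use assms in \<open>auto simp: dihedral_def\<close>)

lemma order_dihedral: "Coset.order (dihedral n) = 2 * n"
  by (simp add: Coset.order_def dihedral_def card_cartesian_product)

definition group_center :: "('a, 'b) monoid_scheme \<Rightarrow> 'a set" where
  "group_center G = {z \<in> carrier G. \<forall>g \<in> carrier G. z \<otimes>\<^bsub>G\<^esub> g = g \<otimes>\<^bsub>G\<^esub> z}"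

definition noncommuting_graph :: "('a, 'b) monoid_scheme \<Rightarrow> 'a pair_pre_digraph" where
  "noncommuting_graph G =
     \<lparr> pverts = carrier G - group_center G,
       parcs = {(x, y). x \<in> carrier G - group_center G \<and> y \<in> carrier G - group_center G \<and>
                        x \<otimes>\<^bsub>G\<^esub> y \<noteq> y \<otimes>\<^bsub>G\<^esub> x} \<rparr>"

lemma pair_graph_noncommuting_graph:
  assumes "finite (carrier G)"
  shows "pair_graph (noncommuting_graph G)"
proof -
  have "parcs (noncommuting_graph G) \<subseteq> carrier G \<times> carrier G"
    by (auto simp: noncommuting_graph_def)
  then have "finite (parcs (noncommuting_graph G))"
    using assms by (meson finite_SigmaI finite_subset)
  then show ?thesis
    using assms
    by unfold_locales (auto simp: noncommuting_graph_def symmetric_def arcs_ends_conv intro!: symI)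
qed

text \<open>The list \<open>vs\<close> enumerates the vertices of the graph without repetition.\<close>

definition adjacency_matrix :: "'a pair_pre_digraph \<Rightarrow> 'a list \<Rightarrow> complex mat" where
  "adjacency_matrix \<Gamma> vs =
     mat (length vs) (length vs) (\<lambda>(i, j). if (vs ! i, vs ! j) \<in> parcs \<Gamma> then 1 else 0)"

text \<open>
  Eigenvalues are counted with algebraic multiplicity; for the adjacency matrix of a simple graph,
  which is real symmetric, this is the same as geometric multiplicity.
\<close>

definition energy :: "complex mat \<Rightarrow> real" where
  "energy A = (\<Sum>\<mu>\<in>spectrum A. real (Polynomial.order \<mu> (char_poly A)) * cmod \<mu>)"

definition cubic_factor :: "nat \<Rightarrow> complex poly" where
  "cubic_factor n = [:16 * of_nat n * (of_nat n - 2), 0, - (2 * of_nat n + 4), - 1:]"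

text \<open>
  \<open>f\<close> is the factor of degree 8 left over in
  \<open>P = ((-x) ^ (15 n\<^sup>2 / 4 - 2 n - 3) / (-x) ^ 4) * (-x - 4) ^ (n\<^sup>2 / 4 - n + 1) * cubic_factor n ^ (n - 2) * f\<close>,
  with the denominator \<open>(-x) ^ 4\<close> cleared. For even \<open>n > 4\<close> the divisions and subtractions of
  natural numbers in the exponents are exact.
\<close>

definition residual_factor :: "nat \<Rightarrow> complex poly \<Rightarrow> complex poly \<Rightarrow> bool" where
  "residual_factor n P f \<longleftrightarrow>
     degree f = 8 \<and>
     P * [:0, - 1:] ^ 4 =
       [:0, - 1:] ^ (15 * n\<^sup>2 div 4 - 2 * n - 3) * [:- 4, - 1:] ^ (n\<^sup>2 div 4 - n + 1) *
       cubic_factor n ^ (n - 2) * f"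

end

theory Submission
  imports Defs "HOL-Computational_Algebra.Field_as_Ring"
begin

text \<open>
  Write \<open>n = 2 m\<close> and let \<open>K\<close> be the matrix of the relation ``\<open>x\<close> and \<open>y\<close> commute'' on \<open>D\<^sub>2\<^sub>n\<close>. Two elements
  of the product commute iff both pairs of components do, so the adjacency matrix acts on a function
  \<open>p \<otimes> q\<close> as \<open>(\<Sum> p) (\<Sum> q) - K p \<otimes> K q\<close>. The function \<open>w\<close> that is \<open>1\<close> on one noncentral class
  \<open>{a\<^sup>i b, a\<^sup>i\<^sup>+\<^sup>m b}\<close> and \<open>- 1\<close> on another has sum \<open>0\<close> and satisfies \<open>K w = 2 w\<close>. Hence \<open>w \<otimes> w'\<close> is an
  eigenvector for \<open>- 4\<close>, and if \<open>K u = \<kappa> u\<close> then \<open>w \<otimes> u\<close> and \<open>u \<otimes> w\<close> are eigenvectors for \<open>- 2 \<kappa>\<close>; for \<open>u\<close>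
  constant on the centre, on the other rotations and on the reflections, the possible values of \<open>- 2 \<kappa>\<close>
  are the roots of the cubic. Elements with the same centraliser give eigenvectors for \<open>0\<close>. For \<open>n > 4\<close>
  the eigenvalues \<open>0\<close>, \<open>- 4\<close> and the three roots of the cubic are distinct, so the characteristic
  polynomial is divisible by the product of the corresponding powers, and the degree of the quotient
  is \<open>8\<close>. The energy is the sum of the absolute values of the roots of the characteristic polynomial,
  which is additive over factors.
\<close>

section \<open>Eigenvectors and multiplicities of the characteristic polynomial\<close>

lemma det_mat_diag: "det (mat_diag n f) = (\<Prod>i<n. f i)"
proof -
  have "det (mat_diag n f) = prod_list (diag_mat (mat_diag n f))"
    by (rule det_upper_triangular[of _ n]) (auto simp: mat_diag_def)
  then show ?thesis
    by (simp add: prod_list_diag_prod mat_diag_def atLeast0LessThan)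
qed

text \<open>
  Replacing column \<open>j \<in> T\<close> of \<open>x I - A\<close> by the combination of all columns with coefficients \<open>q j\<close>
  turns it into \<open>(x - \<mu>) q j\<close>; by \<open>delta\<close> this column operation is invertible.
\<close>

lemma power_dvd_char_poly_mat:
  fixes A :: "'a::field mat" and q :: "nat \<Rightarrow> nat \<Rightarrow> 'a"
  assumes A: "A \<in> carrier_mat N N" and T: "T \<subseteq> {..<N}"
    and delta: "\<And>i j. i \<in> T \<Longrightarrow> j \<in> T \<Longrightarrow> q j i = (if i = j then 1 else 0)"
    and eig: "\<And>i j. j \<in> T \<Longrightarrow> i < N \<Longrightarrow> (\<Sum>k<N. A $$ (i, k) * q j k) = \<mu> * q j i"
  shows "[:- \<mu>, 1:] ^ card T dvd char_poly A"
proof -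
  define E where "E = mat N N (\<lambda>(i, j). if j \<in> T then q j i else if i = j then 1 else 0)"
  have E: "E \<in> carrier_mat N N"
    by (simp add: E_def)
  \<comment> \<open>By \<open>delta\<close>, the rows of \<open>E\<close> indexed by
    \<open>T\<close> are rows of the identity, so a kernel vector vanishes on \<open>T\<close>; the
    columns in \<open>T\<close> then contribute nothing, and each remaining row returns a single
    coordinate.\<close>
  have "det E \<noteq> 0"
  proof
    assume "det E = 0"
    then obtain v where v: "v \<in> carrier_vec N" "v \<noteq> 0\<^sub>v N" "E *\<^sub>v v = 0\<^sub>v N"
      using det_0_iff_vec_prod_zero_field[OF E] by blast
    have row: "(\<Sum>j<N. E $$ (i, j) * v $ j) = 0" if "i < N" for i
      using arg_cong[OF v(3), of "\<lambda>w. w $ i"] that v(1) E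
      by (simp add: scalar_prod_def atLeast0LessThan)
    have vT: "v $ i = 0" if "i \<in> T" for i
    proof -
      have "(\<Sum>j<N. E $$ (i, j) * v $ j) = (\<Sum>j<N. if j = i then v $ j else 0)"
        using that T delta by (intro sum.cong) (auto simp: E_def)
      then show ?thesis
        using row[of i] that T by auto
    qed
    have "v $ i = 0" if "i < N" for i
    proof (cases "i \<in> T")
      case False
      have "(\<Sum>j<N. E $$ (i, j) * v $ j) = (\<Sum>j<N. if j = i then v $ j else 0)"
        using that False vT by (intro sum.cong) (auto simp: E_def)
      then show ?thesis
        using row[of i] that by auto
    qed (rule vT)
    then have "v = 0\<^sub>v N"
      using v(1) by (intro eq_vecI) auto
    with v(2) show False ..
  qed
  define M where "M = char_poly_matrix A"
  have M: "M \<in> carrier_mat N N"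
    using A by (simp add: M_def)
  have M_entry: "M $$ (i, k) = (if i = k then [:0, 1:] else 0) - [:A $$ (i, k):]"
    if "i < N" "k < N" for i k
    using that A by (auto simp: M_def char_poly_matrix_def)
  define E' where "E' = map_mat (\<lambda>a. [:a:]) E"
  define R where "R = mat N N (\<lambda>(i, j). if j \<in> T then [:q j i:] else M $$ (i, j))"
  define D where "D = mat_diag N (\<lambda>j. if j \<in> T then [:- \<mu>, 1:] else 1)"
  have E': "E' \<in> carrier_mat N N" and R: "R \<in> carrier_mat N N" and D: "D \<in> carrier_mat N N"
    using E by (auto simp: E'_def R_def D_def)
  have "M * E' = R * D"
  proof (rule eq_matI)
    fix i j
    assume "i < dim_row (R * D)" "j < dim_col (R * D)"
    then have ij: "i < N" "j < N"
      using R D by auto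
    have "(M * E') $$ (i, j) = (\<Sum>k<N. M $$ (i, k) * [:E $$ (k, j):])"
      using ij M E' E by (simp add: scalar_prod_def E'_def atLeast0LessThan)
    also have "\<dots> = R $$ (i, j) * (if j \<in> T then [:- \<mu>, 1:] else 1)"
    proof (cases "j \<in> T")
      case True
      have "(\<Sum>k<N. M $$ (i, k) * [:E $$ (k, j):]) =
          (\<Sum>k<N. (if k = i then [:0, 1:] * [:q j k:] else 0) - [:A $$ (i, k) * q j k:])"
        using True ij by (intro sum.cong) (auto simp: M_entry E_def)
      also have "\<dots> = [:0, 1:] * [:q j i:] - (\<Sum>k<N. [:A $$ (i, k) * q j k:])"
        using ij by (simp add: sum_subtractf)
      also have "(\<Sum>k<N. [:A $$ (i, k) * q j k:]) = [:\<mu> * q j i:]"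
        using eig[OF True ij(1)] by (simp add: sum_to_poly)
      finally show ?thesis
        using True ij by (simp add: R_def algebra_simps)
    next
      case False
      have "(\<Sum>k<N. M $$ (i, k) * [:E $$ (k, j):]) = (\<Sum>k<N. if k = j then M $$ (i, k) else 0)"
        using False ij by (intro sum.cong) (auto simp: E_def)
      then show ?thesis
        using False ij by (simp add: R_def)
    qed
    also have "\<dots> = (R * D) $$ (i, j)"
      using ij R by (simp add: D_def mat_diag_mult_right)
    finally show "(M * E') $$ (i, j) = (R * D) $$ (i, j)" .
  qed (use M E' R D in auto)
  then have "det M * det E' = det R * det D"
    using det_mult[OF M E'] det_mult[OF R D] by simp
  moreover have "det E' = [:det E:]"
  proof -
    interpret const: comm_ring_hom "\<lambda>a. [:a:] :: 'a poly"
      by unfold_locales auto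
    show ?thesis
      unfolding E'_def by (rule const.hom_det)
  qed
  moreover have "det D = [:- \<mu>, 1:] ^ card T"
  proof -
    have "{..<N} \<inter> T = T"
      using T by auto
    then show ?thesis
      by (simp add: D_def det_mat_diag prod.If_cases)
  qed
  ultimately have "[:- \<mu>, 1:] ^ card T dvd char_poly A * [:det E:]"
    by (metis M_def char_poly_def dvd_triv_right)
  then show ?thesis
    using \<open>det E \<noteq> 0\<close> by (simp add: dvd_smult_iff)
qed

text \<open>The members of \<open>T\<close> play two roles: they label the eigenvectors
  \<open>q t\<close>, and they are the coordinates at which the family is the identity matrix, hence
  linearly independent. Everything is transported from vertices to indices along the enumeration
  \<open>vs\<close>.\<close>

lemma power_dvd_char_poly_adjacency_matrix:
  assumes vs: "distinct vs" "set vs = V" and T: "T \<subseteq> V"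
    and delta: "\<And>s t. s \<in> T \<Longrightarrow> t \<in> T \<Longrightarrow> q t s = (if s = t then 1 else 0)"
    and eig: "\<And>t x. t \<in> T \<Longrightarrow> x \<in> V \<Longrightarrow> (\<Sum>y | y \<in> V \<and> (x, y) \<in> parcs \<Gamma>. q t y) = \<mu> * q t x"
  shows "[:- \<mu>, 1:] ^ card T dvd char_poly (adjacency_matrix \<Gamma> vs)"
proof -
  let ?N = "length vs" and ?A = "adjacency_matrix \<Gamma> vs"
  have bij: "bij_betw ((!) vs) {..<?N} V"
    using bij_betw_nth[OF vs(1), of "{..<?N}" V] vs(2) by simp
  define I where "I = {i. i < ?N \<and> vs ! i \<in> T}"
  have "bij_betw ((!) vs) I T"
    using bij T unfolding bij_betw_def I_def by (auto simp: inj_on_def)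
  then have "card I = card T"
    by (rule bij_betw_same_card)
  moreover have "[:- \<mu>, 1:] ^ card I dvd char_poly ?A"
  proof (rule power_dvd_char_poly_mat)
    show "?A \<in> carrier_mat ?N ?N"
      by (simp add: adjacency_matrix_def)
    show "I \<subseteq> {..<?N}"
      by (auto simp: I_def)
    show "q (vs ! j) (vs ! i) = (if i = j then 1 else 0)" if "i \<in> I" "j \<in> I" for i j
      using that vs(1) by (auto simp: I_def delta nth_eq_iff_index_eq)
    show "(\<Sum>k<?N. ?A $$ (i, k) * q (vs ! j) (vs ! k)) = \<mu> * q (vs ! j) (vs ! i)"
      if "j \<in> I" "i < ?N" for i j
    proof -
      have "(\<Sum>k<?N. ?A $$ (i, k) * q (vs ! j) (vs ! k)) =
          (\<Sum>k<?N. if (vs ! i, vs ! k) \<in> parcs \<Gamma> then q (vs ! j) (vs ! k) else 0)"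
        using that by (intro sum.cong) (auto simp: adjacency_matrix_def)
      also have "\<dots> = (\<Sum>y\<in>V. if (vs ! i, y) \<in> parcs \<Gamma> then q (vs ! j) y else 0)"
        by (rule sum.reindex_bij_betw[OF bij])
      also have "\<dots> = (\<Sum>y | y \<in> V \<and> (vs ! i, y) \<in> parcs \<Gamma>. q (vs ! j) y)"
        using vs(2) by (simp add: sum.inter_filter flip: vs(2))
      also have "\<dots> = \<mu> * q (vs ! j) (vs ! i)"
        using that vs(2) by (intro eig) (auto simp: I_def)
      finally show ?thesis .
    qed
  qed
  ultimately show ?thesis
    by simp
qed

section \<open>Energy as a sum over the multiset of roots\<close>

lemma sum_mset_eq_sum_count:
  fixes f :: "'a \<Rightarrow> 'b::comm_semiring_1"
  shows "(\<Sum>x\<in>#M. f x) = (\<Sum>x\<in>set_mset M. of_nat (count M x) * f x)"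
proof (induction M)
  case (add y M)
  have "(\<Sum>x\<in>set_mset (add_mset y M). of_nat (count (add_mset y M) x) * f x) =
      (\<Sum>x\<in>set_mset (add_mset y M). of_nat (count M x) * f x + (if x = y then f y else 0))"
    by (intro sum.cong) (auto simp: algebra_simps)
  also have "\<dots> = (\<Sum>x\<in>insert y (set_mset M). of_nat (count M x) * f x) + f y"
    by (simp add: sum.distrib)
  also have "(\<Sum>x\<in>insert y (set_mset M). of_nat (count M x) * f x) =
      (\<Sum>x\<in>set_mset M. of_nat (count M x) * f x)"
    by (intro sum.mono_neutral_right) (auto simp: not_in_iff)
  finally show ?case
    using add.IH by (simp add: add.commute)
qed simp

text \<open>The spectrum is the set of roots, and \<open>Polynomial.order\<close> is the
  multiplicity of a root in \<open>proots\<close>. The multiset form is the one that splits over a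
  factorisation.\<close>

lemma energy_eq_sum_proots:
  assumes "A \<in> carrier_mat N N"
  shows "energy A = (\<Sum>\<mu>\<in>#proots (char_poly A). cmod \<mu>)"
proof -
  have nz: "char_poly A \<noteq> 0"
    using degree_monic_char_poly[OF assms] by auto
  have "spectrum A = set_mset (proots (char_poly A))"
    using nz by (auto simp: spectrum_def eigenvalue_root_char_poly[OF assms])
  then show ?thesis
    using nz by (simp add: energy_def sum_mset_eq_sum_count)
qed

section \<open>Noncommuting graphs of direct products\<close>

text \<open>This is the operator of the commuting relation. It is used in place of the adjacency
  operator because the commuting relation on a direct product is the product of the two relations,
  while its complement is not.\<close>

definition commutant_sum :: "('a, 'b) monoid_scheme \<Rightarrow> ('a \<Rightarrow> complex) \<Rightarrow> 'a \<Rightarrow> complex" where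
  "commutant_sum G q x = (\<Sum>y | y \<in> carrier G \<and> x \<otimes>\<^bsub>G\<^esub> y = y \<otimes>\<^bsub>G\<^esub> x. q y)"

text \<open>An element that fails to commute with something is noncentral, so removing the centre
  from the vertex set removes no neighbour. Sums over neighbours can therefore be taken in the whole
  group.\<close>

lemma neighbours_noncommuting_graph:
  assumes "x \<in> pverts (noncommuting_graph G)"
  shows "{y. y \<in> pverts (noncommuting_graph G) \<and> (x, y) \<in> parcs (noncommuting_graph G)} =
    {y \<in> carrier G. x \<otimes>\<^bsub>G\<^esub> y \<noteq> y \<otimes>\<^bsub>G\<^esub> x}"
proof -
  have "y \<notin> group_center G" if "y \<in> carrier G" "x \<otimes>\<^bsub>G\<^esub> y \<noteq> y \<otimes>\<^bsub>G\<^esub> x" for y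
    using that assms by (force simp: noncommuting_graph_def group_center_def)
  then show ?thesis
    using assms by (auto simp: noncommuting_graph_def)
qed

lemma sum_neighbours_noncommuting_graph:
  assumes "finite (carrier G)" "x \<in> pverts (noncommuting_graph G)"
  shows "(\<Sum>y | y \<in> pverts (noncommuting_graph G) \<and> (x, y) \<in> parcs (noncommuting_graph G). q y) =
    sum q (carrier G) - commutant_sum G q x"
proof -
  have "{y \<in> carrier G. x \<otimes>\<^bsub>G\<^esub> y \<noteq> y \<otimes>\<^bsub>G\<^esub> x} =
      carrier G - {y \<in> carrier G. x \<otimes>\<^bsub>G\<^esub> y = y \<otimes>\<^bsub>G\<^esub> x}"
    by auto
  then show ?thesis
    using assms by (simp add: neighbours_noncommuting_graph commutant_sum_def sum_diff)
qed

lemma commutant_sum_DirProd: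
  "commutant_sum (G \<times>\<times> H) (\<lambda>y. p (fst y) * q (snd y)) x =
    commutant_sum G p (fst x) * commutant_sum H q (snd x)"
proof -
  have "{y \<in> carrier (G \<times>\<times> H). x \<otimes>\<^bsub>G \<times>\<times> H\<^esub> y = y \<otimes>\<^bsub>G \<times>\<times> H\<^esub> x} =
      {y \<in> carrier G. fst x \<otimes>\<^bsub>G\<^esub> y = y \<otimes>\<^bsub>G\<^esub> fst x} \<times>
      {y \<in> carrier H. snd x \<otimes>\<^bsub>H\<^esub> y = y \<otimes>\<^bsub>H\<^esub> snd x}"
    by (cases x) auto
  then show ?thesis
    by (simp add: commutant_sum_def sum_product sum.cartesian_product case_prod_beta)
qed

lemma sum_neighbours_noncommuting_graph_DirProd:
  assumes "finite (carrier G)" "finite (carrier H)" "x \<in> pverts (noncommuting_graph (G \<times>\<times> H))"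
  shows "(\<Sum>y | y \<in> pverts (noncommuting_graph (G \<times>\<times> H)) \<and>
        (x, y) \<in> parcs (noncommuting_graph (G \<times>\<times> H)). p (fst y) * q (snd y)) =
    sum p (carrier G) * sum q (carrier H) -
    commutant_sum G p (fst x) * commutant_sum H q (snd x)"
proof -
  have "finite (carrier (G \<times>\<times> H))"
    using assms by simp
  from sum_neighbours_noncommuting_graph[OF this assms(3)] show ?thesis
    by (simp add: commutant_sum_DirProd sum_product sum.cartesian_product case_prod_beta)
qed

lemma group_center_DirProd:
  assumes "group G" "group H"
  shows "group_center (G \<times>\<times> H) = group_center G \<times> group_center H"
proof -
  interpret G: group G by fact
  interpret H: group H by fact
  show ?thesis
    using G.one_closed H.one_closed unfolding group_center_def by force
qed

section \<open>Commutation in dihedral groups\<close>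

lemma carrier_dihedral: "carrier (dihedral n) = {0..<int n} \<times> UNIV"
  by (simp add: dihedral_def)

lemma finite_carrier_dihedral: "finite (carrier (dihedral n))"
  by (simp add: carrier_dihedral)

lemma sum_carrier_dihedral:
  "sum q (carrier (dihedral n)) = (\<Sum>j\<in>{0..<int n}. q (j, False)) + (\<Sum>j\<in>{0..<int n}. q (j, True))"
proof -
  have "sum q (carrier (dihedral n)) = (\<Sum>j\<in>{0..<int n}. \<Sum>s\<in>UNIV. q (j, s))"
    by (simp add: carrier_dihedral sum.cartesian_product)
  then show ?thesis
    by (simp add: UNIV_bool sum.distrib add.commute)
qed

text \<open>The two products of the reflections with indices \<open>i\<close> and \<open>j\<close>
  are the rotations by \<open>i - j\<close> and \<open>j - i\<close>. Their difference is twice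
  \<open>i - j\<close>, and the factor 2 cancels against the modulus.\<close>

lemma two_mult_mod_eq_iff:
  fixes i j m :: int
  shows "(i - j) mod (2 * m) = (j - i) mod (2 * m) \<longleftrightarrow> i mod m = j mod m"
proof -
  have "(i - j) mod (2 * m) = (j - i) mod (2 * m) \<longleftrightarrow> 2 * m dvd (i - j) - (j - i)"
    by (rule mod_eq_dvd_iff)
  also have "(i - j) - (j - i) = 2 * (i - j)"
    by simp
  also have "2 * m dvd 2 * (i - j) \<longleftrightarrow> m dvd i - j"
    by (simp only: dvd_mult_cancel_left) simp
  finally show ?thesis
    by (simp add: mod_eq_dvd_iff)
qed

lemma mod_eq_0_double_range:
  fixes i m :: int
  assumes "0 \<le> i" "i < 2 * m"
  shows "i mod m = 0 \<longleftrightarrow> i \<in> {0, m}"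
proof
  assume "i mod m = 0"
  then obtain k where k: "i = m * k"
    by auto
  have m: "0 < m"
    using assms by linarith
  have "0 \<le> k" "k < 2"
    using assms m unfolding k by (simp_all add: zero_le_mult_iff mult.commute[of m])
  then have "k = 0 \<or> k = 1"
    by linarith
  then show "i \<in> {0, m}"
    using k by auto
qed auto

lemma dihedral_commute_iff:
  assumes "(i, s) \<in> carrier (dihedral (2 * m))" "(j, t) \<in> carrier (dihedral (2 * m))"
  shows "(i, s) \<otimes>\<^bsub>dihedral (2 * m)\<^esub> (j, t) = (j, t) \<otimes>\<^bsub>dihedral (2 * m)\<^esub> (i, s) \<longleftrightarrow>
    (if s then if t then i mod int m = j mod int m else j \<in> {0, int m}
     else t \<longrightarrow> i \<in> {0, int m})"
proof -
  have i: "0 \<le> i" "i < 2 * int m" and j: "0 \<le> j" "j < 2 * int m"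
    using assms by (auto simp: carrier_dihedral)
  \<comment> \<open>The mixed case: the rotation \<open>k\<close> times the reflection
    \<open>l\<close>, in both orders. The indices differ by \<open>2 * k\<close>.\<close>
  have *: "(k + l) mod (2 * int m) = (l - k) mod (2 * int m) \<longleftrightarrow> k \<in> {0, int m}"
    if "0 \<le> k" "k < 2 * int m" for k l
  proof -
    have "(k + l) mod (2 * int m) = (l - k) mod (2 * int m) \<longleftrightarrow> 2 * int m dvd (k + l) - (l - k)"
      by (rule mod_eq_dvd_iff)
    also have "\<dots> \<longleftrightarrow> int m dvd k"
      by simp
    finally show ?thesis
      using mod_eq_0_double_range[OF that] by (simp add: dvd_eq_mod_eq_0)
  qed
  have mult: "(k, a) \<otimes>\<^bsub>dihedral (2 * m)\<^esub> (l, b) = ((if a then k - l else k + l) mod (2 * int m), a \<noteq> b)"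
    for k l a b
    by (simp add: dihedral_def)
  have sym: "(i - j) mod (2 * int m) = (j + i) mod (2 * int m) \<longleftrightarrow> j \<in> {0, int m}"
    using *[OF j, of i] by (simp only: eq_commute)
  show ?thesis
    using sym *[OF i, of j] two_mult_mod_eq_iff[of i j "int m"]
    unfolding mult prod.inject by (cases s; cases t) (simp_all only: if_True if_False add.commute simp_thms)
qed

lemma group_center_dihedral:
  assumes "m > 1"
  shows "group_center (dihedral (2 * m)) = {0, int m} \<times> {False}"
proof (intro Set.set_eqI iffI)
  fix z
  assume z: "z \<in> group_center (dihedral (2 * m))"
  obtain i s where [simp]: "z = (i, s)"
    by (cases z)
  have mem: "(i, s) \<in> carrier (dihedral (2 * m))"
    using z by (simp add: group_center_def)
  have comm: "(i, s) \<otimes>\<^bsub>dihedral (2 * m)\<^esub> (j, t) = (j, t) \<otimes>\<^bsub>dihedral (2 * m)\<^esub> (i, s)"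
    if "(j, t) \<in> carrier (dihedral (2 * m))" for j t
    using z that by (simp add: group_center_def)
  \<comment> \<open>Two test elements suffice: the rotation of index 1 commutes with no reflection,
    because 1 is neither 0 nor \<open>m\<close>, and the reflection of index 0 commutes only with
    the rotations 0 and \<open>m\<close>.\<close>
  have mem': "(0, True) \<in> carrier (dihedral (2 * m))" "(1, False) \<in> carrier (dihedral (2 * m))"
    using assms by (simp_all add: carrier_dihedral)
  have "\<not> s"
    using comm[OF mem'(2)] assms unfolding dihedral_commute_iff[OF mem mem'(2)] by auto
  moreover have "i \<in> {0, int m}"
    using comm[OF mem'(1)] \<open>\<not> s\<close> unfolding dihedral_commute_iff[OF mem mem'(1)] by simp
  ultimately show "z \<in> {0, int m} \<times> {False}"
    by simp
next
  fix z
  assume z: "z \<in> {0, int m} \<times> {False}"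
  then have mem: "z \<in> carrier (dihedral (2 * m))"
    using assms by (auto simp: carrier_dihedral)
  have "z \<otimes>\<^bsub>dihedral (2 * m)\<^esub> g = g \<otimes>\<^bsub>dihedral (2 * m)\<^esub> z"
    if g: "g \<in> carrier (dihedral (2 * m))" for g
  proof -
    obtain i j t where "z = (i, False)" "g = (j, t)" "i \<in> {0, int m}"
      using z by (cases g) auto
    then show ?thesis
      using dihedral_commute_iff[of i False m j t] mem g by simp
  qed
  with mem show "z \<in> group_center (dihedral (2 * m))"
    by (simp add: group_center_def)
qed

lemma commutant_sum_dihedral_rotation:
  assumes "i \<in> {0..<2 * int m}"
  shows "commutant_sum (dihedral (2 * m)) q (i, False) =
    (\<Sum>j\<in>{0..<2 * int m}. q (j, False)) +
    (if i \<in> {0, int m} then \<Sum>j\<in>{0..<2 * int m}. q (j, True) else 0)"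
proof (cases "i \<in> {0, int m}")
  case True
  have "{y \<in> carrier (dihedral (2 * m)).
      (i, False) \<otimes>\<^bsub>dihedral (2 * m)\<^esub> y = y \<otimes>\<^bsub>dihedral (2 * m)\<^esub> (i, False)} = carrier (dihedral (2 * m))"
    using True assms dihedral_commute_iff[of i False m] by (auto simp: carrier_dihedral)
  then show ?thesis
    using True by (simp add: commutant_sum_def sum_carrier_dihedral)
next
  case False
  have "{y \<in> carrier (dihedral (2 * m)).
      (i, False) \<otimes>\<^bsub>dihedral (2 * m)\<^esub> y = y \<otimes>\<^bsub>dihedral (2 * m)\<^esub> (i, False)} =
      (\<lambda>j. (j, False)) ` {0..<2 * int m}" (is "?L = ?R")
  proof (rule Set.set_eqI)
    fix y :: "int \<times> bool"
    obtain j t where y: "y = (j, t)"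
      by (cases y)
    show "y \<in> ?L \<longleftrightarrow> y \<in> ?R"
      using False assms dihedral_commute_iff[of i False m j t]
      by (cases t) (auto simp: y carrier_dihedral)
  qed
  then show ?thesis
    using False by (simp add: commutant_sum_def sum.reindex inj_on_def)
qed

lemma commutant_sum_dihedral_reflection:
  assumes "i \<in> {0..<2 * int m}"
  shows "commutant_sum (dihedral (2 * m)) q (i, True) =
    q (0, False) + q (int m, False) + q (i mod int m, True) + q (i mod int m + int m, True)"
proof -
  have m: "0 < int m"
    using assms by auto
  have i: "i mod int m \<in> {0..<int m}"
    using m by auto
  have mod: "j \<in> {0..<2 * int m} \<and> i mod int m = j mod int m \<longleftrightarrow> j \<in> {i mod int m, i mod int m + int m}" for j
  proof
    assume j: "j \<in> {0..<2 * int m} \<and> i mod int m = j mod int m"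
    show "j \<in> {i mod int m, i mod int m + int m}"
    proof (cases "j < int m")
      case False
      then have "(j - int m) mod int m = j - int m"
        using j by (intro mod_pos_pos_trivial) auto
      then show ?thesis
        using j by simp
    qed (use j in auto)
  qed (use i in auto)
  have "{y \<in> carrier (dihedral (2 * m)).
      (i, True) \<otimes>\<^bsub>dihedral (2 * m)\<^esub> y = y \<otimes>\<^bsub>dihedral (2 * m)\<^esub> (i, True)} =
      {(0, False), (int m, False), (i mod int m, True), (i mod int m + int m, True)}"
    (is "?L = ?R")
  proof (rule Set.set_eqI)
    fix y :: "int \<times> bool"
    obtain j t where y: "y = (j, t)"
      by (cases y)
    show "y \<in> ?L \<longleftrightarrow> y \<in> ?R"
      using m assms mod[of j] dihedral_commute_iff[of i True m j t]
      by (cases t) (auto simp: y carrier_dihedral)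
  qed
  then show ?thesis
    using m by (simp add: commutant_sum_def)
qed

section \<open>Eigenfunctions of the commuting relation on the dihedral group\<close>

lemma sum_mod_double_range:
  fixes g :: "int \<Rightarrow> 'a::comm_semiring_1"
  shows "(\<Sum>j\<in>{0..<2 * int m}. g (j mod int m)) = 2 * (\<Sum>j\<in>{0..<int m}. g j)"
proof -
  have "{0..<2 * int m} = {0..<int m} \<union> {int m..<2 * int m}"
    by auto
  then have "(\<Sum>j\<in>{0..<2 * int m}. g (j mod int m)) =
      (\<Sum>j\<in>{0..<int m}. g (j mod int m)) + (\<Sum>j\<in>{int m..<2 * int m}. g (j mod int m))"
    by (simp add: sum.union_disjoint)
  moreover have "(\<Sum>j\<in>{int m..<2 * int m}. g (j mod int m)) = (\<Sum>j\<in>{0..<int m}. g (j mod int m))"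
    by (rule sum.reindex_bij_witness[of _ "\<lambda>j. j + int m" "\<lambda>j. j - int m"]) auto
  moreover have "(\<Sum>j\<in>{0..<int m}. g (j mod int m)) = (\<Sum>j\<in>{0..<int m}. g j)"
    by (intro sum.cong) auto
  ultimately show ?thesis
    by (simp only: mult_2)
qed

text \<open>
  With \<open>S i = {a\<^sup>i b, a\<^sup>i\<^sup>+\<^sup>m b}\<close>, this is the indicator function of \<open>S (fst d)\<close> minus that of \<open>S 0\<close>.
\<close>

definition reflection_diff :: "nat \<Rightarrow> int \<times> bool \<Rightarrow> int \<times> bool \<Rightarrow> complex" where
  "reflection_diff m d y =
    (if snd y then of_bool (fst y mod int m = fst d) - of_bool (fst y mod int m = 0) else 0)"

lemma sum_reflection_diff_reflections:
  assumes "d \<in> {1..<int m} \<times> {True}"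
  shows "(\<Sum>j\<in>{0..<2 * int m}. reflection_diff m d (j, True)) = 0"
proof -
  have "(\<Sum>j\<in>{0..<2 * int m}. reflection_diff m d (j, True)) =
      2 * (\<Sum>j\<in>{0..<int m}. of_bool (j = fst d) - of_bool (j = 0))"
    using sum_mod_double_range[of "\<lambda>j. of_bool (j = fst d) - of_bool (j = 0) :: complex" m]
    by (simp add: reflection_diff_def)
  also have "\<dots> = 0"
    using assms by (auto simp: sum_subtractf of_bool_def)
  finally show ?thesis .
qed

lemma sum_reflection_diff:
  assumes "d \<in> {1..<int m} \<times> {True}"
  shows "sum (reflection_diff m d) (carrier (dihedral (2 * m))) = 0"
proof -
  have "reflection_diff m d (j, False) = 0" for j
    by (simp add: reflection_diff_def)
  then show ?thesis
    using sum_reflection_diff_reflections[OF assms] by (simp add: sum_carrier_dihedral)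
qed

text \<open>A reflection commutes with the two central elements, where the function is 0, and with
  the two members of its own class, where it takes equal values; hence the factor 2. At a rotation
  both sides vanish, because the values over all reflections cancel.\<close>

lemma commutant_sum_reflection_diff:
  assumes d: "d \<in> {1..<int m} \<times> {True}" and x: "x \<in> carrier (dihedral (2 * m))"
  shows "commutant_sum (dihedral (2 * m)) (reflection_diff m d) x = 2 * reflection_diff m d x"
proof -
  obtain i s where xi: "x = (i, s)"
    by (cases x)
  have i: "i \<in> {0..<2 * int m}"
    using x by (auto simp: xi carrier_dihedral)
  show ?thesis
  proof (cases s)
    case True
    then show ?thesis
      using commutant_sum_dihedral_reflection[OF i, of "reflection_diff m d"]
      by (simp add: xi reflection_diff_def)
  next
    case False
    have "reflection_diff m d (j, False) = 0" for j
      by (simp add: reflection_diff_def)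
    then show ?thesis
      using False commutant_sum_dihedral_rotation[OF i, of "reflection_diff m d"]
        sum_reflection_diff_reflections[OF d]
      by (simp add: xi)
  qed
qed

text \<open>
  The ansatz constant on the centre, on the other rotations and on the reflections, normalised to \<open>1\<close>
  on the centre: the equations for \<open>\<kappa>\<close> at a noncentral rotation and at a reflection give the other
  two values, and the equation at the centre becomes the cubic in \<open>\<kappa>\<close>.
\<close>

definition commutant_eigenfun :: "nat \<Rightarrow> complex \<Rightarrow> int \<times> bool \<Rightarrow> complex" where
  "commutant_eigenfun m \<kappa> y =
    (if snd y then 2 / (\<kappa> - 2) else if fst y \<in> {0, int m} then 1 else 2 / (\<kappa> - 2 * of_nat m + 2))"

lemma commutant_sum_commutant_eigenfun:
  assumes m: "m > 1" and x: "x \<in> carrier (dihedral (2 * m))"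
    and nz: "\<kappa> \<noteq> 2" "\<kappa> \<noteq> 2 * of_nat m - 2"
    and cubic: "\<kappa> ^ 3 - (2 * of_nat m + 2) * \<kappa> ^ 2 + 8 * of_nat m * (of_nat m - 1) = 0"
  shows "commutant_sum (dihedral (2 * m)) (commutant_eigenfun m \<kappa>) x = \<kappa> * commutant_eigenfun m \<kappa> x"
proof -
  define r s where "r = 2 / (\<kappa> - 2 * of_nat m + 2)" and "s = 2 / (\<kappa> - 2)"
  have nz': "\<kappa> - 2 * of_nat m + 2 \<noteq> 0" "\<kappa> - 2 \<noteq> 0"
    using nz by (auto simp: algebra_simps) algebra
  have r: "(\<kappa> - 2 * of_nat m + 2) * r = 2"
    unfolding r_def times_divide_eq_right by (rule nonzero_mult_div_cancel_left[OF nz'(1)])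
  have s: "(\<kappa> - 2) * s = 2"
    unfolding s_def times_divide_eq_right by (rule nonzero_mult_div_cancel_left[OF nz'(2)])
  \<comment> \<open>The equation at the centre, multiplied by the denominators of \<open>r\<close>
    and \<open>s\<close>, is the cubic up to sign; both denominators are nonzero and can be
    cancelled.\<close>
  have "(\<kappa> - 2) * (\<kappa> - 2 * of_nat m + 2) * (2 + (2 * of_nat m - 2) * r + 2 * of_nat m * s - \<kappa>) = 0"
  proof -
    have "(\<kappa> - 2) * (\<kappa> - 2 * of_nat m + 2) * (2 + (2 * of_nat m - 2) * r + 2 * of_nat m * s - \<kappa>) =
        (\<kappa> - 2) * (\<kappa> - 2 * of_nat m + 2) * (2 - \<kappa>) +
        (\<kappa> - 2) * (2 * of_nat m - 2) * ((\<kappa> - 2 * of_nat m + 2) * r) +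
        (\<kappa> - 2 * of_nat m + 2) * (2 * of_nat m) * ((\<kappa> - 2) * s)"
      by (simp add: algebra_simps)
    also have "\<dots> = - (\<kappa> ^ 3 - (2 * of_nat m + 2) * \<kappa> ^ 2 + 8 * of_nat m * (of_nat m - 1))"
      unfolding r s by (simp add: algebra_simps power3_eq_cube power2_eq_square)
    finally show ?thesis
      using cubic by simp
  qed
  then have centre: "2 + (2 * of_nat m - 2) * r + 2 * of_nat m * s = \<kappa>"
    using nz' by (simp only: mult_eq_0_iff) simp
  have rotations: "(\<Sum>j\<in>{0..<2 * int m}. commutant_eigenfun m \<kappa> (j, False)) = 2 + (2 * of_nat m - 2) * r"
  proof -
    have "(\<Sum>j\<in>{0..<2 * int m}. commutant_eigenfun m \<kappa> (j, False)) =
        (\<Sum>j\<in>{0..<2 * int m} - {0, int m}. commutant_eigenfun m \<kappa> (j, False)) +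
        (\<Sum>j\<in>{0, int m}. commutant_eigenfun m \<kappa> (j, False))"
      using m by (intro sum.subset_diff) auto
    also have "(\<Sum>j\<in>{0..<2 * int m} - {0, int m}. commutant_eigenfun m \<kappa> (j, False)) =
        (\<Sum>j\<in>{0..<2 * int m} - {0, int m}. r)"
      by (intro sum.cong) (auto simp: commutant_eigenfun_def r_def)
    also have "(\<Sum>j\<in>{0, int m}. commutant_eigenfun m \<kappa> (j, False)) = 2"
      using m by (simp add: commutant_eigenfun_def)
    finally have "(\<Sum>j\<in>{0..<2 * int m}. commutant_eigenfun m \<kappa> (j, False)) =
        of_nat (card ({0..<2 * int m} - {0, int m})) * r + 2"
      by simp
    moreover have "card ({0..<2 * int m} - {0, int m}) = 2 * m - 2"
      using m by (subst card_Diff_subset) auto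
    ultimately show ?thesis
      using m by (simp add: of_nat_diff)
  qed
  have reflections: "(\<Sum>j\<in>{0..<2 * int m}. commutant_eigenfun m \<kappa> (j, True)) = 2 * of_nat m * s"
    by (simp add: commutant_eigenfun_def s_def)
  have eval: "commutant_eigenfun m \<kappa> (j, False) = (if j \<in> {0, int m} then 1 else r)"
    "commutant_eigenfun m \<kappa> (j, True) = s" for j
    by (simp_all add: commutant_eigenfun_def r_def s_def)
  obtain i t where xi: "x = (i, t)"
    by (cases x)
  have i: "i \<in> {0..<2 * int m}"
    using x by (auto simp: xi carrier_dihedral)
  \<comment> \<open>The equations at a noncentral rotation and at a reflection are the defining
    equations of \<open>r\<close> and \<open>s\<close>, rearranged.\<close>
  have rot: "2 + (2 * of_nat m - 2) * r = \<kappa> * r" and ref: "2 + 2 * s = \<kappa> * s"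
    using r s by (simp_all add: algebra_simps)
  show ?thesis
  proof (cases t)
    case True
    then show ?thesis
      using commutant_sum_dihedral_reflection[OF i, of "commutant_eigenfun m \<kappa>"] ref
      by (simp add: xi eval add.commute)
  next
    case False
    have "commutant_sum (dihedral (2 * m)) (commutant_eigenfun m \<kappa>) (i, False) =
        2 + (2 * of_nat m - 2) * r + (if i \<in> {0, int m} then 2 * of_nat m * s else 0)"
      unfolding commutant_sum_dihedral_rotation[OF i] rotations reflections ..
    also have "\<dots> = \<kappa> * (if i \<in> {0, int m} then 1 else r)"
      by (cases "i \<in> {0, int m}") (simp_all only: if_True if_False add_0_right mult_1_right centre, rule rot)
    finally show ?thesis
      using False by (simp only: xi eval)
  qed
qed

section \<open>Classes of elements with equal centralisers\<close>

definition commuting_rep :: "nat \<Rightarrow> int \<times> bool \<Rightarrow> int \<times> bool" where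
  "commuting_rep m d =
    (if snd d then (fst d mod int m, True) else (of_bool (fst d \<notin> {0, int m}), False))"

text \<open>The reflections fall into \<open>m\<close> pairs, represented by their index modulo
  \<open>m\<close>; the two central elements are represented by the rotation 0 and all other
  rotations by the rotation 1.\<close>

definition commuting_reps :: "nat \<Rightarrow> (int \<times> bool) set" where
  "commuting_reps m = {0..<int m} \<times> {True} \<union> {0, 1} \<times> {False}"

lemma card_commuting_reps: "card (commuting_reps m) = m + 2"
  unfolding commuting_reps_def by (subst card_Un_disjoint) (auto simp: card_cartesian_product)

lemma commuting_rep_in_commuting_reps:
  "m > 1 \<Longrightarrow> commuting_rep m d \<in> commuting_reps m"
  by (auto simp: commuting_rep_def commuting_reps_def)

lemma commuting_reps_subset_carrier: "m > 1 \<Longrightarrow> commuting_reps m \<subseteq> carrier (dihedral (2 * m))"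
  by (auto simp: commuting_reps_def carrier_dihedral)

lemma commute_commuting_rep_iff:
  assumes m: "m > 1" and "x \<in> carrier (dihedral (2 * m))" "d \<in> carrier (dihedral (2 * m))"
  shows "x \<otimes>\<^bsub>dihedral (2 * m)\<^esub> commuting_rep m d = commuting_rep m d \<otimes>\<^bsub>dihedral (2 * m)\<^esub> x \<longleftrightarrow>
    x \<otimes>\<^bsub>dihedral (2 * m)\<^esub> d = d \<otimes>\<^bsub>dihedral (2 * m)\<^esub> x"
proof -
  have r: "commuting_rep m d \<in> carrier (dihedral (2 * m))"
    using m commuting_rep_in_commuting_reps commuting_reps_subset_carrier by blast
  obtain i s j t where x: "x = (i, s)" and d: "d = (j, t)"
    by (cases x; cases d)
  \<comment> \<open>Passing to the representative keeps exactly what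
    \<open>dihedral_commute_iff\<close> looks at: the residue modulo \<open>m\<close> of a
    reflection, and for a rotation whether it is central.\<close>
  obtain j' where rep: "commuting_rep m d = (j', t)"
    "t \<Longrightarrow> j' mod int m = j mod int m" "\<not> t \<Longrightarrow> j' \<in> {0, int m} \<longleftrightarrow> j \<in> {0, int m}"
    using m by (cases t) (auto simp: d commuting_rep_def)
  show ?thesis
    using assms(2,3) r rep(2,3) unfolding x rep(1) unfolding d
    by (cases t) (simp_all only: dihedral_commute_iff if_True if_False simp_thms)
qed

section \<open>Eigenvectors of the noncommuting graph\<close>

definition square_graph :: "nat \<Rightarrow> ((int \<times> bool) \<times> (int \<times> bool)) pair_pre_digraph" where
  "square_graph m = noncommuting_graph (dihedral (2 * m) \<times>\<times> dihedral (2 * m))"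

lemma pverts_square_graph:
  assumes "m > 1"
  shows "pverts (square_graph m) =
    carrier (dihedral (2 * m)) \<times> carrier (dihedral (2 * m)) -
    ({0, int m} \<times> {False}) \<times> ({0, int m} \<times> {False})"
  using assms
  by (simp add: square_graph_def noncommuting_graph_def group_center_DirProd group_dihedral
      group_center_dihedral)

lemma pverts_square_graph_subset:
  "pverts (square_graph m) \<subseteq> carrier (dihedral (2 * m)) \<times> carrier (dihedral (2 * m))"
  by (auto simp: square_graph_def noncommuting_graph_def)

lemma card_pverts_square_graph:
  assumes "m > 1"
  shows "card (pverts (square_graph m)) = 16 * m ^ 2 - 4"
proof -
  have "({0, int m} \<times> {False}) \<times> ({0, int m} \<times> {False}) \<subseteq>
      carrier (dihedral (2 * m)) \<times> carrier (dihedral (2 * m))"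
    using assms by (auto simp: carrier_dihedral)
  moreover have "card (carrier (dihedral (2 * m))) = 4 * m"
    using order_dihedral[of "2 * m"] by (simp add: Coset.order_def)
  ultimately show ?thesis
    using assms
    by (simp add: pverts_square_graph card_Diff_subset card_cartesian_product power2_eq_square)
qed

context
  fixes m :: nat and vs :: "((int \<times> bool) \<times> (int \<times> bool)) list"
  assumes m: "m > 1" and vs: "distinct vs" "set vs = pverts (square_graph m)"
begin

lemma sum_neighbours_square_graph:
  assumes "x \<in> pverts (square_graph m)"
  shows "(\<Sum>y | y \<in> pverts (square_graph m) \<and> (x, y) \<in> parcs (square_graph m).
      p (fst y) * q (snd y)) =
    sum p (carrier (dihedral (2 * m))) * sum q (carrier (dihedral (2 * m))) -
    commutant_sum (dihedral (2 * m)) p (fst x) * commutant_sum (dihedral (2 * m)) q (snd x)"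
  using assms unfolding square_graph_def
  by (intro sum_neighbours_noncommuting_graph_DirProd finite_carrier_dihedral)

lemma reflection_diff_delta:
  assumes "d \<in> {1..<int m} \<times> {True}" "e \<in> {1..<int m} \<times> {True}"
  shows "reflection_diff m d e = (if e = d then 1 else 0)"
  using assms by (auto simp: reflection_diff_def dest: zdvd_imp_le)

text \<open>A vertex \<open>t\<close> and its representative have the same neighbours, so the
  difference of their indicator functions is in the kernel. The exponent counts the vertices that
  are not pairs of representatives: \<open>(16 * m ^ 2 - 4) - ((m + 2) ^ 2 - 1)\<close>.\<close>

lemma nonrepresentatives_dvd_char_poly:
  "[:0, 1:] ^ (15 * m ^ 2 - 4 * m - 7) dvd char_poly (adjacency_matrix (square_graph m) vs)"
proof -
  let ?D = "dihedral (2 * m)" and ?V = "pverts (square_graph m)"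
  define R where "R = commuting_reps m \<times> commuting_reps m"
  define rep where "rep t = (commuting_rep m (fst t), commuting_rep m (snd t))" for t
  define q :: "_ \<Rightarrow> _ \<Rightarrow> complex" where "q t y = of_bool (y = t) - of_bool (y = rep t)" for t y
  have R: "R \<subseteq> carrier ?D \<times> carrier ?D"
    using commuting_reps_subset_carrier[OF m] by (auto simp: R_def)
  have rep: "rep t \<in> R" for t
    using commuting_rep_in_commuting_reps[OF m] by (simp add: R_def rep_def)
  have "[:- 0, 1:] ^ card (?V - R) dvd char_poly (adjacency_matrix (square_graph m) vs)"
  proof (rule power_dvd_char_poly_adjacency_matrix[OF vs, where q = q])
    show "q t s = (if s = t then 1 else 0)" if "s \<in> ?V - R" "t \<in> ?V - R" for s t
      using that rep[of t] by (auto simp: q_def)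
    fix t x
    assume t: "t \<in> ?V - R" and x: "x \<in> ?V"
    then have tD: "t \<in> carrier (?D \<times>\<times> ?D)" and xD: "x \<in> carrier (?D \<times>\<times> ?D)"
      using pverts_square_graph_subset by auto
    have rD: "rep t \<in> carrier (?D \<times>\<times> ?D)"
      using R rep[of t] unfolding carrier_DirProd by (rule subsetD)
    have fin: "finite (carrier (?D \<times>\<times> ?D))"
      by (simp add: finite_carrier_dihedral)
    have comm: "x \<otimes>\<^bsub>?D \<times>\<times> ?D\<^esub> rep t = rep t \<otimes>\<^bsub>?D \<times>\<times> ?D\<^esub> x \<longleftrightarrow> x \<otimes>\<^bsub>?D \<times>\<times> ?D\<^esub> t = t \<otimes>\<^bsub>?D \<times>\<times> ?D\<^esub> x"
    proof -
      have "fst x \<in> carrier ?D" "snd x \<in> carrier ?D" "fst t \<in> carrier ?D" "snd t \<in> carrier ?D"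
        using tD xD by auto
      then show ?thesis
        using commute_commuting_rep_iff[OF m, of "fst x" "fst t"]
          commute_commuting_rep_iff[OF m, of "snd x" "snd t"]
        unfolding rep_def mult_DirProd' by (simp add: mult_DirProd')
    qed
    have "(\<Sum>y | y \<in> ?V \<and> (x, y) \<in> parcs (square_graph m). q t y) =
        (\<Sum>y\<in>{y \<in> carrier (?D \<times>\<times> ?D). x \<otimes>\<^bsub>?D \<times>\<times> ?D\<^esub> y \<noteq> y \<otimes>\<^bsub>?D \<times>\<times> ?D\<^esub> x}. q t y)"
      using x neighbours_noncommuting_graph[of x "?D \<times>\<times> ?D"] by (simp only: square_graph_def)
    also have "\<dots> = of_bool (x \<otimes>\<^bsub>?D \<times>\<times> ?D\<^esub> t \<noteq> t \<otimes>\<^bsub>?D \<times>\<times> ?D\<^esub> x) -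
        of_bool (x \<otimes>\<^bsub>?D \<times>\<times> ?D\<^esub> rep t \<noteq> rep t \<otimes>\<^bsub>?D \<times>\<times> ?D\<^esub> x)"
      using fin tD rD unfolding q_def sum_subtractf of_bool_def
      by (subst (1 2) sum.delta) (simp_all del: carrier_DirProd)
    finally show "(\<Sum>y | y \<in> ?V \<and> (x, y) \<in> parcs (square_graph m). q t y) = 0 * q t x"
      by (simp add: comm)
  qed auto
  moreover have "card (?V - R) = 15 * m ^ 2 - 4 * m - 7"
  proof -
    \<comment> \<open>The pair of identities is the only central element among the pairs of
      representatives.\<close>
    have "?V \<inter> R = R - {((0, False), (0, False))}"
      using m R unfolding pverts_square_graph[OF m] R_def commuting_reps_def by auto
    moreover have "((0, False), (0, False)) \<in> R"
      by (simp add: R_def commuting_reps_def)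
    moreover have "finite R"
      by (simp add: R_def commuting_reps_def)
    moreover have "card R = (m + 2) ^ 2"
      by (simp add: R_def card_cartesian_product card_commuting_reps power2_eq_square)
    ultimately have "card (?V \<inter> R) = (m + 2) ^ 2 - 1"
      by simp
    moreover have "card (?V - R) = card ?V - card (?V \<inter> R)"
      by (intro card_Diff_subset_Int) (simp add: R_def commuting_reps_def)
    ultimately have "card (?V - R) = (16 * m ^ 2 - 4) - ((m + 2) ^ 2 - 1)"
      using card_pverts_square_graph[OF m] by simp
    moreover have "(m + 2) ^ 2 = m ^ 2 + 4 * m + 4"
      by (simp add: power2_eq_square algebra_simps)
    ultimately show ?thesis
      by simp
  qed
  ultimately show ?thesis
    by simp
qed

text \<open>Products of two functions \<open>reflection_diff\<close>: the total sums vanish and each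
  factor contributes the eigenvalue 2, giving \<open>- (2 * 2)\<close>. Labelled by pairs of
  reflections with indices from 1 to \<open>m - 1\<close>, they are dual to evaluation at their
  labels.\<close>

lemma reflections_dvd_char_poly:
  "[:4, 1:] ^ ((m - 1) ^ 2) dvd char_poly (adjacency_matrix (square_graph m) vs)"
proof -
  let ?D = "dihedral (2 * m)" and ?V = "pverts (square_graph m)"
  define W where "W = {1..<int m} \<times> {True}"
  have "[:- (- 4), 1:] ^ card (W \<times> W) dvd char_poly (adjacency_matrix (square_graph m) vs)"
  proof (rule power_dvd_char_poly_adjacency_matrix[OF vs,
        where q = "\<lambda>t y. reflection_diff m (fst t) (fst y) * reflection_diff m (snd t) (snd y)"])
    show "W \<times> W \<subseteq> ?V"
      unfolding pverts_square_graph[OF m] by (auto simp: W_def carrier_dihedral)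
    show "reflection_diff m (fst t) (fst s) * reflection_diff m (snd t) (snd s) = (if s = t then 1 else 0)"
      if "s \<in> W \<times> W" "t \<in> W \<times> W" for s t
    proof -
      have mem: "fst s \<in> W" "snd s \<in> W" "fst t \<in> W" "snd t \<in> W"
        using that by auto
      show ?thesis
        using reflection_diff_delta[folded W_def, OF mem(3,1)]
          reflection_diff_delta[folded W_def, OF mem(4,2)]
        by (simp only: prod_eq_iff[of s t]) simp
    qed
    show "(\<Sum>y | y \<in> ?V \<and> (x, y) \<in> parcs (square_graph m).
        reflection_diff m (fst t) (fst y) * reflection_diff m (snd t) (snd y)) =
        - 4 * (reflection_diff m (fst t) (fst x) * reflection_diff m (snd t) (snd x))"
      if t: "t \<in> W \<times> W" and x: "x \<in> ?V" for t x
    proof -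
      have "fst x \<in> carrier ?D" "snd x \<in> carrier ?D"
        using subsetD[OF pverts_square_graph_subset x] by (simp_all add: mem_Times_iff)
      moreover have "fst t \<in> {1..<int m} \<times> {True}" "snd t \<in> {1..<int m} \<times> {True}"
        using t unfolding W_def by auto
      ultimately show ?thesis
        unfolding sum_neighbours_square_graph[OF x]
        by (simp only: sum_reflection_diff commutant_sum_reflection_diff) simp
    qed
  qed
  moreover have "card (W \<times> W) = (m - 1) ^ 2"
    using m by (simp add: W_def card_cartesian_product power2_eq_square nat_diff_distrib)
  ultimately show ?thesis
    by simp
qed

text \<open>It is enough that one factor has sum 0: the product of the total sums vanishes whatever
  the sum of \<open>commutant_eigenfun\<close> is, and the eigenvalue is minus the product of 2 and
  \<open>\<kappa>\<close>.\<close>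

lemma mixed_dvd_char_poly:
  assumes nz: "\<kappa> \<noteq> 2" "\<kappa> \<noteq> 2 * of_nat m - 2"
    and cubic: "\<kappa> ^ 3 - (2 * of_nat m + 2) * \<kappa> ^ 2 + 8 * of_nat m * (of_nat m - 1) = 0"
  shows "[:2 * \<kappa>, 1:] ^ (2 * m - 2) dvd char_poly (adjacency_matrix (square_graph m) vs)"
proof -
  let ?D = "dihedral (2 * m)" and ?V = "pverts (square_graph m)" and ?o = "(0 :: int, False)"
  define W where "W = {1..<int m} \<times> {True}"
  define u where "u = commutant_eigenfun m \<kappa>"
  \<comment> \<open>The identity \<open>?o\<close> labels the factor \<open>u\<close>. Since
    \<open>u\<close> is 1 there and \<open>reflection_diff\<close> is 0 there, the two families with
    \<open>u\<close> in the second and in the first component are jointly dual to their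
    labels.\<close>
  define q where "q t y = (if snd t = ?o then reflection_diff m (fst t) (fst y) * u (snd y)
    else u (fst y) * reflection_diff m (snd t) (snd y))" for t y
  have "[:- (- 2 * \<kappa>), 1:] ^ card (W \<times> {?o} \<union> {?o} \<times> W) dvd
      char_poly (adjacency_matrix (square_graph m) vs)"
  proof (rule power_dvd_char_poly_adjacency_matrix[OF vs, where q = q])
    show "W \<times> {?o} \<union> {?o} \<times> W \<subseteq> ?V"
      using m unfolding pverts_square_graph[OF m] by (auto simp: W_def carrier_dihedral)
    have u: "u ?o = 1" "reflection_diff m d ?o = 0" for d
      by (simp_all add: u_def commutant_eigenfun_def reflection_diff_def)
    have W: "?o \<notin> W" "d \<in> W \<Longrightarrow> d \<noteq> ?o" "d \<in> W \<Longrightarrow> ?o \<noteq> d" for d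
      by (auto simp: W_def)
    show "q t s = (if s = t then 1 else 0)"
      if "s \<in> W \<times> {?o} \<union> {?o} \<times> W" "t \<in> W \<times> {?o} \<union> {?o} \<times> W" for s t
      using that by (elim UnE SigmaE singletonE)
        (simp_all add: q_def u W reflection_diff_delta[folded W_def])
    show "(\<Sum>y | y \<in> ?V \<and> (x, y) \<in> parcs (square_graph m). q t y) = - 2 * \<kappa> * q t x"
      if t: "t \<in> W \<times> {?o} \<union> {?o} \<times> W" and x: "x \<in> ?V" for t x
    proof -
      have x': "fst x \<in> carrier ?D" "snd x \<in> carrier ?D"
        using subsetD[OF pverts_square_graph_subset x] by (simp_all add: mem_Times_iff)
      note eigen = commutant_sum_commutant_eigenfun[OF m _ nz cubic, folded u_def]
      show ?thesis
      proof (cases "snd t = ?o")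
        case True
        then have "fst t \<in> {1..<int m} \<times> {True}"
          using t W by (auto simp: W_def)
        moreover have "q t = (\<lambda>y. reflection_diff m (fst t) (fst y) * u (snd y))"
          using True by (simp add: q_def fun_eq_iff)
        ultimately show ?thesis
          using x' sum_neighbours_square_graph[OF x, of "reflection_diff m (fst t)" u]
          by (simp add: sum_reflection_diff commutant_sum_reflection_diff eigen)
      next
        case False
        then have "snd t \<in> {1..<int m} \<times> {True}"
          using t by (auto simp: W_def)
        moreover have "q t = (\<lambda>y. u (fst y) * reflection_diff m (snd t) (snd y))"
          using False by (simp add: q_def fun_eq_iff)
        ultimately show ?thesis
          using x' sum_neighbours_square_graph[OF x, of u "reflection_diff m (snd t)"]
          by (simp add: sum_reflection_diff commutant_sum_reflection_diff eigen)
      qed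
    qed
  qed
  moreover have "card (W \<times> {?o} \<union> {?o} \<times> W) = 2 * m - 2"
  proof -
    have "(W \<times> {?o}) \<inter> ({?o} \<times> W) = {}" "finite W" "card W = m - 1"
      using m by (auto simp: W_def card_cartesian_product nat_diff_distrib)
    then show ?thesis
      by (simp add: card_Un_disjoint card_cartesian_product)
  qed
  ultimately show ?thesis
    by simp
qed

end

section \<open>Factorisation and energy\<close>

lemma coprime_linear_poly:
  fixes a b :: "'a::field_gcd"
  assumes "a \<noteq> b"
  shows "coprime [:- a, 1:] [:- b, 1:]"
proof (rule coprimeI)
  fix c
  assume "c dvd [:- a, 1:]" "c dvd [:- b, 1:]"
  then have "c dvd [:- a, 1:] - [:- b, 1:]"
    by (rule dvd_diff)
  moreover have "is_unit ([:- a, 1:] - [:- b, 1:])"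
    using assms by (simp add: is_unit_const_poly_iff)
  ultimately show "is_unit c"
    by (rule dvd_trans)
qed

section \<open>Roots of the cubic factor\<close>

lemma cubic_factor_nonzero: "cubic_factor n \<noteq> 0"
  by (simp add: cubic_factor_def)

lemma degree_cubic_factor: "degree (cubic_factor n) = 3"
  by (simp add: cubic_factor_def)

lemma cubic_factor_eq_prod:
  assumes "proots (cubic_factor n) = {#a, b, c#}"
  shows "cubic_factor n = - ([:- a, 1:] * [:- b, 1:] * [:- c, 1:])"
proof -
  have "lead_coeff (cubic_factor n) = - 1"
    by (simp add: cubic_factor_def)
  then show ?thesis
    using complex_poly_decompose_multiset[of "cubic_factor n"] assms by (simp add: algebra_simps)
qed

text \<open>A double root would force \<open>4 (m + 1)\<^sup>3 = 27 m (m - 1)\<close>.\<close>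

lemma cubic_factor_first_two_roots_distinct:
  assumes "proots (cubic_factor (2 * m)) = {#a, b, c#}" and m: "m > 1"
  shows "a \<noteq> b"
proof
  assume "a = b"
  have "cubic_factor (2 * m) = - ([:- a, 1:] * [:- a, 1:] * [:- c, 1:])"
    using cubic_factor_eq_prod[OF assms(1)] \<open>a = b\<close> by simp
  \<comment> \<open>Comparison of coefficients for a double root \<open>a\<close> and a third root
    \<open>c\<close>; the vanishing linear coefficient forces \<open>a = - 2 * c\<close>.\<close>
  then have e: "a * a * c = 16 * of_nat (2 * m) * (of_nat (2 * m) - 2)" "a * a + 2 * a * c = 0"
    "2 * a + c = - (2 * of_nat (2 * m) + 4)"
    unfolding cubic_factor_def by (simp_all add: algebra_simps)
  have "a \<noteq> 0"
    using e(1) m by (auto simp: of_nat_diff[symmetric])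
  moreover have "a * (a + 2 * c) = 0"
    using e(2) by (simp add: algebra_simps)
  ultimately have ac: "a = - 2 * c"
    by (simp add: eq_neg_iff_add_eq_0)
  then have c: "3 * c = 4 * of_nat m + 4"
    using e(3) by (simp add: algebra_simps)
  have "27 * (a * a * c) = 4 * (3 * c) ^ 3"
    unfolding ac by (simp add: power3_eq_cube)
  then have "27 * (64 * of_nat m * (of_nat m - 1)) = (4 :: complex) * (4 * of_nat m + 4) ^ 3"
    unfolding e(1) c by (simp add: algebra_simps)
  \<comment> \<open>The contradiction comes from positivity, so the identity is moved to the
    reals.\<close>
  then have "complex_of_real (27 * (64 * real m * (real m - 1))) = complex_of_real (4 * (4 * real m + 4) ^ 3)"
    by simp
  then have "27 * (64 * real m * (real m - 1)) = 4 * (4 * real m + 4) ^ 3"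
    by (simp only: of_real_eq_iff)
  then have "16 * (real m * (4 * (real m)\<^sup>2 - 15 * real m + 39) + 4) = 0"
    by (simp add: power2_eq_square power3_eq_cube algebra_simps)
  moreover have sq: "4 * (real m)\<^sup>2 - 15 * real m + 39 = ((8 * real m - 15)\<^sup>2 + 399) / 16"
    by (simp add: power2_eq_square field_simps)
  have "0 \<le> 4 * (real m)\<^sup>2 - 15 * real m + 39"
    unfolding sq by (intro divide_nonneg_pos add_nonneg_nonneg zero_le_power2) simp_all
  then have "real m * (4 * (real m)\<^sup>2 - 15 * real m + 39) \<ge> 0"
    by simp
  then have "0 < 16 * (real m * (4 * (real m)\<^sup>2 - 15 * real m + 39) + 4)"
    by (intro mult_pos_pos add_nonneg_pos) simp_all
  ultimately show False
    by (simp only: less_irrefl)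
qed

lemma cubic_factor_roots_distinct:
  assumes "proots (cubic_factor (2 * m)) = {#a, b, c#}" and "m > 1"
  shows "a \<noteq> b" "a \<noteq> c" "b \<noteq> c"
proof -
  show "a \<noteq> b"
    by (rule cubic_factor_first_two_roots_distinct[OF assms])
  show "a \<noteq> c"
    using assms by (intro cubic_factor_first_two_roots_distinct[of m a c b]) (simp_all add: add_mset_commute)
  show "b \<noteq> c"
    using assms by (intro cubic_factor_first_two_roots_distinct[of m b c a]) (simp_all add: add_mset_commute)
qed

text \<open>With \<open>a = - 2 * \<kappa>\<close>, the values \<open>- 4\<close> and
  \<open>- 4 * m + 4\<close> correspond to the zeros 2 and \<open>2 * m - 2\<close> of the
  denominators in \<open>commutant_eigenfun\<close>. The cubic takes the values
  \<open>64 * m * (m - 2)\<close> and \<open>- 64 * (m - 1) * (m - 2)\<close> there, which is where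
  \<open>m > 2\<close>, that is \<open>n > 4\<close>, enters. Excluding 0 and \<open>- 4\<close>
  also separates the roots from the other known eigenvalues.\<close>

lemma cubic_factor_root_properties:
  assumes root: "poly (cubic_factor (2 * m)) a = 0" and m: "m > 2"
  shows "a \<noteq> 0" "a \<noteq> - 4" "a \<noteq> - 4 * of_nat m + 4"
    "(- a / 2) ^ 3 - (2 * of_nat m + 2) * (- a / 2) ^ 2 + 8 * of_nat m * (of_nat m - 1) = 0"
proof -
  have eq: "64 * of_nat m * (of_nat m - 1) - (4 * of_nat m + 4) * a ^ 2 - a ^ 3 = 0"
    using root by (simp add: cubic_factor_def algebra_simps power2_eq_square power3_eq_cube)
  have nz: "complex_of_nat m \<noteq> 0" "complex_of_nat m - 1 \<noteq> 0" "complex_of_nat m - 2 \<noteq> 0"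
    using m of_nat_eq_iff[of m 1, where 'a = complex] of_nat_eq_iff[of m 2, where 'a = complex]
    by auto
  show "a \<noteq> 0"
    using eq nz by auto
  show "a \<noteq> - 4"
  proof
    assume "a = - 4"
    then have "64 * of_nat m * (of_nat m - 2) = (0 :: complex)"
      using eq by (simp add: algebra_simps)
    with nz show False
      by simp
  qed
  show "a \<noteq> - 4 * of_nat m + 4"
  proof
    assume a: "a = - 4 * of_nat m + 4"
    have "64 * of_nat m * (of_nat m - 1) - (4 * of_nat m + 4) * a ^ 2 - a ^ 3 =
        - 64 * ((of_nat m - 1) * (of_nat m - 2))"
      unfolding a by (simp add: power2_eq_square power3_eq_cube algebra_simps)
    with eq nz show False
      by simp
  qed
  have "(- a / 2) ^ 3 - (2 * of_nat m + 2) * (- a / 2) ^ 2 + 8 * of_nat m * (of_nat m - 1) =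
      (64 * of_nat m * (of_nat m - 1) - (4 * of_nat m + 4) * a ^ 2 - a ^ 3) / 8"
    by (simp add: power2_eq_square power3_eq_cube field_simps)
  then show "(- a / 2) ^ 3 - (2 * of_nat m + 2) * (- a / 2) ^ 2 + 8 * of_nat m * (of_nat m - 1) = 0"
    using eq by simp
qed

section \<open>The product of the known factors\<close>

text \<open>The five linear factors, for 0, \<open>- 4\<close> and the three roots, are pairwise
  coprime, so the separate divisibilities by their powers multiply.\<close>

lemma known_factors_dvd_char_poly:
  assumes m: "m > 2" and vs: "distinct vs" "set vs = pverts (square_graph m)"
    and roots: "proots (cubic_factor (2 * m)) = {#a, b, c#}"
  shows "[:0, 1:] ^ (15 * m ^ 2 - 4 * m - 7) * [:4, 1:] ^ ((m - 1) ^ 2) *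
    cubic_factor (2 * m) ^ (2 * m - 2) dvd char_poly (adjacency_matrix (square_graph m) vs)"
    (is "?lhs dvd ?P")
proof -
  let ?k = "2 * m - 2"
  have m1: "m > 1"
    using m by simp
  have root: "poly (cubic_factor (2 * m)) x = 0" if "x \<in> {a, b, c}" for x
  proof -
    have "x \<in># proots (cubic_factor (2 * m))"
      using that roots by auto
    then show ?thesis
      using cubic_factor_nonzero by simp
  qed
  have dvd: "[:- x, 1:] ^ ?k dvd ?P" if "x \<in> {a, b, c}" for x
  proof -
    note props = cubic_factor_root_properties[OF root[OF that] m]
    define k where "k = - x / 2"
    have x: "x = - 2 * k"
      by (simp add: k_def)
    have "k \<noteq> 2"
      using props(2) unfolding x by auto
    moreover have "k \<noteq> 2 * of_nat m - 2"
    proof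
      assume k: "k = 2 * of_nat m - 2"
      show False
        using props(3) unfolding x k by (simp add: algebra_simps)
    qed
    ultimately have "k \<noteq> 2" "k \<noteq> 2 * of_nat m - 2" .
    from mixed_dvd_char_poly[OF m1 vs this props(4)[folded k_def]] show ?thesis
      by (simp add: x)
  qed
  have coprime: "coprime ([:- x, 1:] ^ k) ([:- y, 1:] ^ l)" if "x \<noteq> y" for x y :: complex and k l
    using coprime_linear_poly[OF that] by simp
  have coprime0: "coprime ([:0, 1:] ^ k) ([:- y, 1:] ^ l)" if "y \<noteq> 0" for y :: complex and k l
    using coprime[of 0 y k l] that by simp
  have coprime4: "coprime ([:4, 1:] ^ k) ([:- y, 1:] ^ l)" if "y \<noteq> - 4" for y :: complex and k l
    using coprime[of "- 4" y k l] that by simp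
  have coprime04: "coprime ([:0, 1:] ^ k) ([:4, 1:] ^ l :: complex poly)" for k l
    using coprime0[of "- 4" k l] by simp
  note distinct = cubic_factor_roots_distinct[OF roots m1]
  have nz: "x \<noteq> 0" "x \<noteq> - 4" if "x \<in> {a, b, c}" for x
    using cubic_factor_root_properties(1,2)[OF root[OF that] m] by auto
  have "[:0, 1:] ^ (15 * m ^ 2 - 4 * m - 7) * [:4, 1:] ^ ((m - 1) ^ 2) * [:- a, 1:] ^ ?k *
      [:- b, 1:] ^ ?k * [:- c, 1:] ^ ?k dvd ?P"
    using nz distinct
    by (intro divides_mult nonrepresentatives_dvd_char_poly reflections_dvd_char_poly dvd m1 vs
        coprime coprime0 coprime4 coprime04 coprime_mult_left_iff[THEN iffD2] conjI) auto
  moreover have "cubic_factor (2 * m) ^ ?k = ([:- a, 1:] * [:- b, 1:] * [:- c, 1:]) ^ ?k"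
    \<comment> \<open>The cubic has leading coefficient \<open>- 1\<close>; the even exponent
      \<open>2 * m - 2\<close> absorbs the sign.\<close>
    unfolding cubic_factor_eq_prod[OF roots] by (rule power_minus_even) simp
  ultimately show ?thesis
    by (simp only: power_mult_distrib mult.assoc)
qed

section \<open>Sums of moduli of roots, additive over factors\<close>

definition modulus_sum :: "complex poly \<Rightarrow> real" where
  "modulus_sum p = (\<Sum>x\<in>#proots p. cmod x)"

lemma modulus_sum_mult: "p \<noteq> 0 \<Longrightarrow> q \<noteq> 0 \<Longrightarrow> modulus_sum (p * q) = modulus_sum p + modulus_sum q"
  by (simp add: modulus_sum_def proots_mult)

lemma modulus_sum_power: "p \<noteq> 0 \<Longrightarrow> modulus_sum (p ^ k) = real k * modulus_sum p"
proof (induction k)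
  case 0
  then show ?case
    by (simp add: modulus_sum_def)
next
  case (Suc k)
  then show ?case
    by (simp add: modulus_sum_mult algebra_simps)
qed

lemma modulus_sum_linear: "modulus_sum [:- a, - 1:] = cmod a"
proof -
  have "[:- a, - 1:] = - [:a, 1:]"
    by simp
  then have "proots [:- a, - 1:] = {#- a#}"
    by (simp only: proots_uminus proots_linear_factor)
  then show ?thesis
    by (simp add: modulus_sum_def)
qed

lemma modulus_sum_neg_X: "modulus_sum [:0, - 1:] = 0"
  using modulus_sum_linear[of 0] by simp

theorem corollary3p4:
  fixes n :: nat
    and vs :: "((int \<times> bool) \<times> (int \<times> bool)) list"
    and A :: "complex mat"
    and \<alpha>1 \<alpha>2 \<alpha>3 :: complex
  assumes "even n" and "n > 4"
    and "distinct vs"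
    and "set vs = pverts (noncommuting_graph (dihedral n \<times>\<times> dihedral n))"
    and "A = adjacency_matrix (noncommuting_graph (dihedral n \<times>\<times> dihedral n)) vs"
    and "proots (cubic_factor n) = {#\<alpha>1, \<alpha>2, \<alpha>3#}"
  shows "(\<exists>!f. residual_factor n (char_poly A) f) \<and>
    (\<forall>f (\<gamma> :: nat \<Rightarrow> complex).
       residual_factor n (char_poly A) f \<and> proots f = image_mset \<gamma> (mset_set {1..8}) \<longrightarrow>
       energy A =
         (real n ^ 2 - 4 * real n + 4) +
         (real n - 2) * (cmod \<alpha>1 + cmod \<alpha>2 + cmod \<alpha>3) +
         (\<Sum>i = 1..8. cmod (\<gamma> i)))"
proof -
  obtain m where n: "n = 2 * m"
    using assms(1) by blast
  have m: "m > 2"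
    using assms(2) n by simp
  have vs: "distinct vs" "set vs = pverts (square_graph m)"
    and A: "A = adjacency_matrix (square_graph m) vs"
    using assms(3-5) by (simp_all add: n square_graph_def)
  note roots = assms(6)[unfolded n]
  let ?P = "char_poly A" and ?C = "cubic_factor (2 * m)"
  let ?a = "15 * n\<^sup>2 div 4 - 2 * n - 3" and ?b = "n\<^sup>2 div 4 - n + 1"
  define R where "R = [:0, - 1:] ^ ?a * [:- 4, - 1:] ^ ?b * ?C ^ (2 * m - 2)"
  have "m * m \<ge> 3 * m"
    using m by (intro mult_le_mono1) simp
  then have size: "m ^ 2 \<ge> 3 * m"
    by (simp only: power2_eq_square)
  \<comment> \<open>The exponent exceeds the multiplicity found for 0 by 4, which matches the
    cleared denominator. The bound \<open>size\<close> makes the subtractions of natural numbers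
    exact.\<close>
  have a: "?a = (15 * m ^ 2 - 4 * m - 7) + 4"
  proof -
    have "15 * n\<^sup>2 div 4 = 15 * m ^ 2"
      by (simp add: n power_mult_distrib)
    then show ?thesis
      using size m n by simp
  qed
  have b: "?b = (m - 1) ^ 2"
  proof -
    have "n\<^sup>2 div 4 = m ^ 2"
      by (simp add: n power_mult_distrib)
    moreover have "(m - 1) ^ 2 + 2 * m = m ^ 2 + 1"
      using m by (cases m) (simp_all add: power2_eq_square)
    ultimately show ?thesis
      using size n by simp
  qed
  have residual: "residual_factor n ?P f \<longleftrightarrow> degree f = 8 \<and> ?P * [:0, - 1:] ^ 4 = R * f" for f
    unfolding residual_factor_def R_def n by simp
  have R0: "R \<noteq> 0"
    unfolding R_def by (simp only: mult_eq_0_iff power_eq_0_iff cubic_factor_nonzero pCons_eq_0_iff) simp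
  have A_dim: "A \<in> carrier_mat (length vs) (length vs)"
    by (simp add: A adjacency_matrix_def)
  have "length vs = 16 * m ^ 2 - 4"
    using card_pverts_square_graph[of m] m distinct_card[OF vs(1)] vs(2) by simp
  then have degP: "degree ?P = 16 * m ^ 2 - 4"
    using degree_monic_char_poly[OF A_dim] by simp
  then have P0: "?P \<noteq> 0"
    using degree_monic_char_poly[OF A_dim] by auto
  have "R dvd ?P * [:0, - 1:] ^ 4"
  proof -
    have neg: "[:- x, - 1:] ^ k dvd [:x, 1:] ^ k" for x :: complex and k
      by (intro dvd_power_same dvdI[of _ _ "- 1"]) simp
    have "[:0, - 1:] ^ (15 * m ^ 2 - 4 * m - 7) * [:- 4, - 1:] ^ ?b * ?C ^ (2 * m - 2) dvd
        [:0, 1:] ^ (15 * m ^ 2 - 4 * m - 7) * [:4, 1:] ^ ((m - 1) ^ 2) * ?C ^ (2 * m - 2)"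
      unfolding b using neg[of 0] neg[of 4] by (intro mult_dvd_mono) simp_all
    also have "\<dots> dvd ?P"
      unfolding A by (rule known_factors_dvd_char_poly[OF m vs roots])
    finally have "[:0, - 1:] ^ (15 * m ^ 2 - 4 * m - 7) * [:- 4, - 1:] ^ ?b * ?C ^ (2 * m - 2) *
        [:0, - 1:] ^ 4 dvd ?P * [:0, - 1:] ^ 4"
      by (rule mult_dvd_mono) simp
    then show ?thesis
      unfolding R_def a power_add by (simp only: ac_simps)
  qed
  then obtain f where f: "?P * [:0, - 1:] ^ 4 = R * f"
    by blast
  have "f \<noteq> 0"
    using f P0 by auto
  \<comment> \<open>Degree count: the left side has degree \<open>16 * m ^ 2\<close> and
    \<open>R\<close> has degree \<open>16 * m ^ 2 - 8\<close>, which leaves 8 for the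
    cofactor.\<close>
  have "degree R = ?a + ?b + 3 * (2 * m - 2)"
    unfolding R_def b
    by (simp add: degree_mult_eq degree_power_eq cubic_factor_nonzero degree_cubic_factor)
  moreover have "degree (?P * [:0, - 1:] ^ 4) = 16 * m ^ 2 - 4 + 4"
    using P0 degP by (simp add: degree_mult_eq degree_power_eq)
  ultimately have "16 * m ^ 2 - 4 + 4 = (15 * m ^ 2 - 4 * m - 7) + 4 + (m - 1) ^ 2 + 3 * (2 * m - 2) + degree f"
    using \<open>f \<noteq> 0\<close> R0 a b unfolding f by (simp add: degree_mult_eq)
  moreover have "(m - 1) ^ 2 + 2 * m = m ^ 2 + 1"
    using m by (cases m) (simp_all add: power2_eq_square)
  ultimately have "degree f = 8"
    using size m by simp
  have "\<exists>!f. residual_factor n ?P f"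
  proof (rule ex1I[of _ f])
    show "residual_factor n ?P f"
      unfolding residual using f \<open>degree f = 8\<close> by simp
    show "g = f" if "residual_factor n ?P g" for g
      using that f R0 unfolding residual by simp
  qed
  moreover have "energy A = (real n ^ 2 - 4 * real n + 4) +
      (real n - 2) * (cmod \<alpha>1 + cmod \<alpha>2 + cmod \<alpha>3) + (\<Sum>i = 1..8. cmod (\<gamma> i))"
    if g: "residual_factor n ?P g" and \<gamma>: "proots g = image_mset \<gamma> (mset_set {1..8})" for g \<gamma>
  proof -
    have eq: "?P * [:0, - 1:] ^ 4 = R * g" and "g \<noteq> 0"
      using g unfolding residual by auto
    \<comment> \<open>The extra factor contributes only zero roots, so it does not change the sum of
      moduli.\<close>
    have "energy A = modulus_sum (?P * [:0, - 1:] ^ 4)"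
      using P0 energy_eq_sum_proots[OF A_dim]
      by (simp add: modulus_sum_mult modulus_sum_power modulus_sum_neg_X flip: modulus_sum_def)
    also have "\<dots> = real ?b * 4 + real (2 * m - 2) * modulus_sum ?C + modulus_sum g"
      using \<open>g \<noteq> 0\<close> R0 cubic_factor_nonzero modulus_sum_linear[of 4] unfolding eq R_def b
      by (simp add: modulus_sum_mult modulus_sum_power modulus_sum_neg_X)
    also have "real ?b = (real m - 1) ^ 2"
      using m unfolding b by (simp add: of_nat_diff)
    also have "(real m - 1) ^ 2 * 4 = real n ^ 2 - 4 * real n + 4"
      by (simp add: n power2_eq_square algebra_simps)
    also have "real (2 * m - 2) = real n - 2"
      using m by (simp add: n of_nat_diff)
    also have "modulus_sum ?C = cmod \<alpha>1 + cmod \<alpha>2 + cmod \<alpha>3"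
      by (simp add: modulus_sum_def roots)
    also have "modulus_sum g = (\<Sum>i = 1..8. cmod (\<gamma> i))"
      by (simp add: modulus_sum_def \<gamma> image_mset.compositionality comp_def sum_unfold_sum_mset)
    finally show ?thesis .
  qed
  ultimately show ?thesis
    by blast
qed

end
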